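(* Let $R=\{(0,0),(0,1),(0,2),(3,0),(1,1),(2,1),(2,2),(2,3),(3,1),(3,3)\}$ and $R'=\{(0,0),(1,0),(2,0),(0,3),(1,1),(1,2),(1,3),(2,2),(3,2),(3,3)\}$. Then $(123,R)\sim_{jd}(132,R)$ and $(123,R')\sim_{jd}(132,R')$.
   Context: $S_n$ is the set of permutations $\pi=\pi_1\cdots\pi_n$ of $\{1,\dots,n\}$. A mesh pattern of length $k$ is a pair $(\tau,R)$ with $\tau\in S_k$ and $R\subseteq\{0,\dots,k\}\times\{0,\dots,k\}$ (the set of shaded boxes; box $(a,b)$ is the unit square with lower-left corner $(a,b)$). An occurrence of $(\tau,R)$ in $\pi\in S_n$ is a subsequence $\pi_{i_1}\cdots\pi_{i_k}$, $i_1<\dots<i_k$, order-isomorphic to $\tau$, such that, with $i_0=0$, $i_{k+1}=n+1$, with $v_1<\dots<v_k$ the values $\pi_{i_1},\dots,\pi_{i_k}$ in increasing order, and $v_0=0$, $v_{k+1}=n+1$, for each $(a,b)\in R$ there is no index $m$ with $i_a<m<i_{a+1}$ and $v_b<\pi_m<v_{b+1}$. Two mesh patterns $q_1,q_2$ are jointly equidistributed, written $q_1\sim_{jd}q_2$, if for all nonnegative integers $n,k,\ell$ the number of $\pi\in S_n$ with exactly $k$ occurrences of $q_1$ and $\ell$ occurrences of $q_2$ equals the number of $\pi\in S_n$ with exactly $\ell$ occurrences of $q_1$ and $k$ occurrences of $q_2$. *)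

theory Defs
  imports "HOL-Combinatorics.Combinatorics"
begin

text \<open>
  A permutation \<open>\<pi> \<in> S\<^sub>n\<close> is a function with \<open>\<pi> permutes {1..n}\<close>, so that \<open>\<pi>\<^sub>m\<close> is \<open>\<pi> m\<close>.
  A mesh pattern is a pair \<open>(\<tau>, R)\<close>, with \<open>\<tau> \<in> S\<^sub>k\<close> written in one-line notation as a list of
  length \<open>k\<close> and \<open>R \<subseteq> {0..k} \<times> {0..k}\<close> its set of shaded boxes.
\<close>

type_synonym mesh_pattern = "nat list \<times> (nat \<times> nat) set"

definition order_isomorphic :: "nat list \<Rightarrow> nat list \<Rightarrow> bool" where
  "order_isomorphic xs ys \<longleftrightarrow>
     length xs = length ys \<and>
     (\<forall>a < length xs. \<forall>b < length xs. xs ! a < xs ! b \<longleftrightarrow> ys ! a < ys ! b)"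

text \<open>
  An occurrence is given by its list of positions \<open>is = [i\<^sub>1, \<dots>, i\<^sub>k]\<close>. The two auxiliary lists below
  are \<open>[i\<^sub>0, i\<^sub>1, \<dots>, i\<^sub>k, i\<^sub>k\<^sub>+\<^sub>1]\<close> and \<open>[v\<^sub>0, v\<^sub>1, \<dots>, v\<^sub>k, v\<^sub>k\<^sub>+\<^sub>1]\<close>, so their entries at index \<open>a\<close> and
  \<open>b\<close> are \<open>i\<^sub>a\<close> and \<open>v\<^sub>b\<close>.
\<close>

definition occurrence :: "nat \<Rightarrow> (nat \<Rightarrow> nat) \<Rightarrow> mesh_pattern \<Rightarrow> nat list \<Rightarrow> bool" where
  "occurrence n \<pi> q is \<longleftrightarrow>
     sorted_wrt (<) is \<and> set is \<subseteq> {1..n} \<and>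
     order_isomorphic (map \<pi> is) (fst q) \<and>
     (let i = 0 # is @ [n + 1];
          v = 0 # sort (map \<pi> is) @ [n + 1]
      in \<forall>(a, b) \<in> snd q.
           \<not> (\<exists>m. i ! a < m \<and> m < i ! (a + 1) \<and> v ! b < \<pi> m \<and> \<pi> m < v ! (b + 1)))"

definition num_occurrences :: "nat \<Rightarrow> (nat \<Rightarrow> nat) \<Rightarrow> mesh_pattern \<Rightarrow> nat" where
  "num_occurrences n \<pi> q = card {is. occurrence n \<pi> q is}"

definition jointly_equidistributed :: "mesh_pattern \<Rightarrow> mesh_pattern \<Rightarrow> bool"
    (infix "\<sim>jd" 50) where
  "q1 \<sim>jd q2 \<longleftrightarrow>
     (\<forall>n k l.
        card {\<pi>. \<pi> permutes {1..n} \<and> num_occurrences n \<pi> q1 = k \<and> num_occurrences n \<pi> q2 = l} =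
        card {\<pi>. \<pi> permutes {1..n} \<and> num_occurrences n \<pi> q1 = l \<and> num_occurrences n \<pi> q2 = k})"

end

theory Submission
  imports Defs
begin

text \<open>
  An occurrence of \<open>(123, R)\<close> or \<open>(132, R)\<close> splits the permutation as \<open>A a B b C c D\<close> or
  \<open>A a B c C b D\<close> with \<open>a < b < c\<close>, where \<open>A > c\<close>, no entry of \<open>B\<close> lies between \<open>a\<close> and \<open>b\<close>,
  \<open>C < a\<close>, and \<open>b < D < c\<close>. All occurrences, of either pattern, share the same \<open>a\<close>, and \<open>a\<close>
  determines an occurrence of a given pattern, so each pattern occurs at most once. Exchanging \<open>b\<close>
  and \<open>c\<close> is a bijection between the permutations containing \<open>(123, R)\<close> and those containing
  \<open>(132, R)\<close>, which suffices because both counts are at most one. Since \<open>R'\<close> is the transpose of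
  \<open>R\<close> and \<open>123\<close>, \<open>132\<close> are involutions, the second claim follows by inverting permutations.
\<close>

section \<open>Reduction of joint equidistribution to one equality of cardinalities\<close>

text \<open>With both counts at most one, the only case not settled by emptiness or by
  \<open>k = l\<close> is (1,0) against (0,1). These two classes arise from the two sets in
  \<open>eq\<close> by removing the same class \<open>S 1 1\<close>, so they have equal
  size.\<close>

lemma jointly_equidistributedI:
  assumes le1: "\<And>n \<pi>. \<pi> permutes {1..n} \<Longrightarrow> num_occurrences n \<pi> q1 \<le> 1"
    and le2: "\<And>n \<pi>. \<pi> permutes {1..n} \<Longrightarrow> num_occurrences n \<pi> q2 \<le> 1"
    and eq: "\<And>n. card {\<pi>. \<pi> permutes {1..n} \<and> num_occurrences n \<pi> q1 = 1} =
                   card {\<pi>. \<pi> permutes {1..n} \<and> num_occurrences n \<pi> q2 = 1}"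
  shows "q1 \<sim>jd q2"
  unfolding jointly_equidistributed_def
proof (intro allI)
  fix n k l :: nat
  let ?N1 = "\<lambda>\<pi>. num_occurrences n \<pi> q1" and ?N2 = "\<lambda>\<pi>. num_occurrences n \<pi> q2"
  define S where "S k l = {\<pi>. \<pi> permutes {1..n} \<and> ?N1 \<pi> = k \<and> ?N2 \<pi> = l}" for k l
  have fin: "finite (S k l)" for k l
    by (rule finite_subset[OF _ finite_permutations[of "{1..n}"]]) (auto simp: S_def)
  have empty: "S k l = {}" if "k > 1 \<or> l > 1" for k l
    using that le1[of _ n] le2[of _ n] by (fastforce simp: S_def)
  have "{\<pi>. \<pi> permutes {1..n} \<and> ?N1 \<pi> = 1} = S 1 0 \<union> S 1 1"
    using le2[of _ n] by (fastforce simp: S_def le_Suc_eq)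
  moreover have "{\<pi>. \<pi> permutes {1..n} \<and> ?N2 \<pi> = 1} = S 0 1 \<union> S 1 1"
    using le1[of _ n] by (fastforce simp: S_def le_Suc_eq)
  moreover have "S 1 0 \<inter> S 1 1 = {}" "S 0 1 \<inter> S 1 1 = {}"
    by (auto simp: S_def)
  ultimately have "card (S 1 0) = card (S 0 1)"
    using eq[of n] fin by (simp add: card_Un_disjoint)
  moreover have "k > 1 \<or> l > 1 \<or> k = l \<or> (k = 1 \<and> l = 0) \<or> (k = 0 \<and> l = 1)"
    by presburger
  ultimately have "card (S k l) = card (S l k)"
    using empty[of k l] empty[of l k] by auto
  moreover have "S l k = {\<pi>. \<pi> permutes {1..n} \<and> ?N1 \<pi> = l \<and> ?N2 \<pi> = k}"
    by (simp add: S_def)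
  ultimately show "card {\<pi>. \<pi> permutes {1..n} \<and> ?N1 \<pi> = k \<and> ?N2 \<pi> = l} =
      card {\<pi>. \<pi> permutes {1..n} \<and> ?N1 \<pi> = l \<and> ?N2 \<pi> = k}"
    by (simp add: S_def)
qed

text \<open>\<open>card\<close> is 0 on infinite sets, so only finiteness lets a count of 0, or of
  at most 1, say that occurrences are absent or unique.\<close>

lemma finite_occurrences: "finite {is. occurrence n \<pi> q is}"
proof (rule finite_subset)
  show "{is. occurrence n \<pi> q is} \<subseteq> {is. set is \<subseteq> {1..n} \<and> length is = length (fst q)}"
    by (auto simp: occurrence_def order_isomorphic_def)
qed (simp add: finite_lists_length_eq)

text \<open>Uniqueness makes the projection \<open>fst\<close> injective on the pairs. A bijection
  between pairs is easier to define, since it can refer to the positions of the occurrence.\<close>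

lemma card_unique_occurrence:
  assumes "\<And>\<pi>. \<pi> permutes {1..n} \<Longrightarrow> num_occurrences n \<pi> q \<le> 1"
  shows "card {\<pi>. \<pi> permutes {1..n} \<and> num_occurrences n \<pi> q = 1} =
    card {(\<pi>, is). \<pi> permutes {1..n} \<and> occurrence n \<pi> q is}"
proof -
  have "inj_on fst {(\<pi>, is). \<pi> permutes {1..n} \<and> occurrence n \<pi> q is}"
  proof (rule inj_onI, clarsimp)
    fix \<pi> xs ys
    assume "\<pi> permutes {Suc 0..n}" and occ: "occurrence n \<pi> q xs" "occurrence n \<pi> q ys"
    then have "card {is. occurrence n \<pi> q is} \<le> Suc 0"
      using assms[of \<pi>] by (simp add: num_occurrences_def)
    then show "xs = ys"
      using occ finite_occurrences[of n \<pi> q] by (auto simp: card_le_Suc0_iff_eq)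
  qed
  moreover have "fst ` {(\<pi>, is). \<pi> permutes {1..n} \<and> occurrence n \<pi> q is} =
      {\<pi>. \<pi> permutes {1..n} \<and> num_occurrences n \<pi> q = 1}"
  proof -
    have "num_occurrences n \<pi> q = 1 \<longleftrightarrow> (\<exists>is. occurrence n \<pi> q is)" if "\<pi> permutes {1..n}" for \<pi>
    proof -
      have "num_occurrences n \<pi> q = 0 \<longleftrightarrow> \<not> (\<exists>is. occurrence n \<pi> q is)"
        using finite_occurrences[of n \<pi> q] by (auto simp: num_occurrences_def)
      then show ?thesis
        using assms[OF that] by (auto simp: le_Suc_eq)
    qed
    then show ?thesis by (force simp: image_iff)
  qed
  ultimately show ?thesis
    using card_image by fastforce
qed

section \<open>Block structure of an occurrence\<close>

text \<open>The block form \<open>A a B b C c D\<close> or \<open>A a B c C b D\<close> with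
  \<open>a = \<pi> i\<close>. The values \<open>b\<close> and \<open>c\<close> are parameters not
  tied to \<open>\<pi> j\<close> and \<open>\<pi> k\<close>, so that one predicate serves both
  patterns and ignores an exchange of the entries at \<open>j\<close> and \<open>k\<close>.\<close>

definition split_at :: "nat \<Rightarrow> (nat \<Rightarrow> nat) \<Rightarrow> nat \<Rightarrow> nat \<Rightarrow> nat \<Rightarrow> nat \<Rightarrow> nat \<Rightarrow> bool" where
  "split_at n \<pi> i j k b c \<longleftrightarrow>
     1 \<le> i \<and> i < j \<and> j < k \<and> k \<le> n \<and> \<pi> i < b \<and> b < c \<and>
     (\<forall>m \<in> {1..n} - {i, j, k}.
        (m < i \<longrightarrow> c < \<pi> m) \<and>
        (i < m \<and> m < j \<longrightarrow> \<pi> m < \<pi> i \<or> b < \<pi> m) \<and>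
        (j < m \<and> m < k \<longrightarrow> \<pi> m < \<pi> i) \<and>
        (k < m \<longrightarrow> b < \<pi> m \<and> \<pi> m < c))"

abbreviation shading :: "(nat \<times> nat) set" where
  "shading \<equiv> {(0,0), (0,1), (0,2), (3,0), (1,1), (2,1), (2,2), (2,3), (3,1), (3,3)}"

lemma length_3_conv: "length xs = 3 \<longleftrightarrow> (\<exists>x y z. xs = [x, y, z])"
  by (auto simp: numeral_3_eq_3 length_Suc_conv)

lemma all_less_3: "(\<forall>a < Suc (Suc (Suc 0)). P a) \<longleftrightarrow> P 0 \<and> P 1 \<and> P 2"
  by (auto simp: less_Suc_eq numeral_2_eq_2)

lemma order_isomorphic_123:
  "order_isomorphic xs [1,2,3] \<longleftrightarrow> (\<exists>x y z. xs = [x, y, z] \<and> x < y \<and> y < z)"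
proof -
  have "order_isomorphic xs [1,2,3] \<Longrightarrow> length xs = 3"
    by (simp add: order_isomorphic_def)
  then show ?thesis
    unfolding length_3_conv by (fastforce simp: order_isomorphic_def all_less_3)
qed

lemma order_isomorphic_132:
  "order_isomorphic xs [1,3,2] \<longleftrightarrow> (\<exists>x y z. xs = [x, y, z] \<and> x < z \<and> z < y)"
proof -
  have "order_isomorphic xs [1,3,2] \<Longrightarrow> length xs = 3"
    by (simp add: order_isomorphic_def)
  then show ?thesis
    unfolding length_3_conv by (fastforce simp: order_isomorphic_def all_less_3)
qed

lemma map_eq_3_conv:
  "map f xs = [x, y, z] \<longleftrightarrow> (\<exists>i j k. xs = [i, j, k] \<and> x = f i \<and> y = f j \<and> z = f k)"
  by (auto simp: map_eq_Cons_conv)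

text \<open>In each column the unshaded boxes are the values allowed in the matching block: only
  above \<open>c\<close> in column 0, all but those between \<open>\<pi> i\<close> and
  \<open>b\<close> in column 1, only below \<open>\<pi> i\<close> in column 2, only between
  \<open>b\<close> and \<open>c\<close> in column 3. The unordered condition on
  \<open>{b, c}\<close> covers both patterns.\<close>

lemma shading_conv_split_at:
  assumes \<pi>: "\<pi> permutes {1..n}" and ord: "1 \<le> i" "i < j" "j < k" "k \<le> n"
    and val: "\<pi> i < b" "b < c" "{b, c} = {\<pi> j, \<pi> k}"
  shows "(\<forall>(x, y) \<in> shading. \<not> (\<exists>m. (0 # [i, j, k] @ [n + 1]) ! x < m \<and>
            m < (0 # [i, j, k] @ [n + 1]) ! (x + 1) \<and>
            (0 # [\<pi> i, b, c] @ [n + 1]) ! y < \<pi> m \<and> \<pi> m < (0 # [\<pi> i, b, c] @ [n + 1]) ! (y + 1)))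
         \<longleftrightarrow> split_at n \<pi> i j k b c" (is "?L \<longleftrightarrow> _")
proof -
  \<comment> \<open>One conjunct per shaded box, in the order of \<open>shading\<close>. Comparisons
    with the outer borders 0 and \<open>n + 1\<close> are dropped, as they hold for every
    \<open>m\<close> in \<open>{1..n}\<close>.\<close>
  define Q where "Q m \<longleftrightarrow>
      \<not> (m < i \<and> \<pi> m < \<pi> i) \<and> \<not> (m < i \<and> \<pi> i < \<pi> m \<and> \<pi> m < b) \<and>
      \<not> (m < i \<and> b < \<pi> m \<and> \<pi> m < c) \<and> \<not> (k < m \<and> \<pi> m < \<pi> i) \<and>
      \<not> (i < m \<and> m < j \<and> \<pi> i < \<pi> m \<and> \<pi> m < b) \<and>
      \<not> (j < m \<and> m < k \<and> \<pi> i < \<pi> m \<and> \<pi> m < b) \<and>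
      \<not> (j < m \<and> m < k \<and> b < \<pi> m \<and> \<pi> m < c) \<and> \<not> (j < m \<and> m < k \<and> c < \<pi> m) \<and>
      \<not> (k < m \<and> \<pi> i < \<pi> m \<and> \<pi> m < b) \<and> \<not> (k < m \<and> c < \<pi> m)" for m
  have range: "1 \<le> \<pi> m \<and> \<pi> m \<le> n" if "1 \<le> m" "m \<le> n" for m
    using permutes_in_image[OF \<pi>, of m] that by simp
  define I where "I = 0 # [i, j, k] @ [n + 1]"
  define V where "V = 0 # [\<pi> i, b, c] @ [n + 1]"
  have I: "I ! 0 = 0" "I ! 1 = i" "I ! 2 = j" "I ! 3 = k" "I ! 4 = n + 1"
    by (simp_all add: I_def)
  have V: "V ! 0 = 0" "V ! 1 = \<pi> i" "V ! 2 = b" "V ! 3 = c" "V ! 4 = n + 1"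
    by (simp_all add: V_def)
  \<comment> \<open>The \<open>m\<close> in \<open>occurrence\<close> ranges over all naturals, but
    every column lies strictly between 0 and \<open>n + 1\<close>, so an \<open>m\<close> outside
    \<open>{1..n}\<close> falls in no box.\<close>
  have box: "(\<forall>(x, y) \<in> shading. \<not> (I ! x < m \<and> m < I ! (x + 1) \<and> V ! y < \<pi> m \<and> \<pi> m < V ! (y + 1)))
      \<longleftrightarrow> (m \<in> {1..n} \<longrightarrow> Q m)" for m
  proof -
    have 1: "(0::nat) + 1 = 1" "(1::nat) + 1 = 2" "(2::nat) + 1 = 3" "(3::nat) + 1 = 4" by simp_all
    show ?thesis
    proof (cases "m \<in> {1..n}")
      case True
      then have "0 < m" "m < n + 1" "0 < \<pi> m" "\<pi> m < n + 1"
        using range[of m] by auto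
      then show ?thesis
        unfolding ball_simps case_prod_conv 1 I V Q_def using True by simp
    next
      case False
      then have "m = 0 \<or> n < m" by auto
      then have "\<not> (0 < m \<and> m < i)" "\<not> (i < m \<and> m < j)" "\<not> (j < m \<and> m < k)" "\<not> (k < m \<and> m < n + 1)"
        using ord by linarith+
      then show ?thesis
        unfolding ball_simps case_prod_conv 1 I V using False by blast
    qed
  qed
  have "?L \<longleftrightarrow> (\<forall>m. \<forall>(x, y) \<in> shading.
      \<not> (I ! x < m \<and> m < I ! (x + 1) \<and> V ! y < \<pi> m \<and> \<pi> m < V ! (y + 1)))"
    unfolding I_def V_def by blast
  also have "\<dots> \<longleftrightarrow> (\<forall>m \<in> {1..n}. Q m)"
    unfolding box by blast
  also have "\<dots> \<longleftrightarrow> split_at n \<pi> i j k b c"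
  proof -
    have inj: "\<pi> x = \<pi> y \<longleftrightarrow> x = y" for x y
      using permutes_inj[OF \<pi>] by (simp add: inj_eq)
    define Z where "Z m \<longleftrightarrow> (m < i \<longrightarrow> c < \<pi> m) \<and>
        (i < m \<and> m < j \<longrightarrow> \<pi> m < \<pi> i \<or> b < \<pi> m) \<and>
        (j < m \<and> m < k \<longrightarrow> \<pi> m < \<pi> i) \<and>
        (k < m \<longrightarrow> b < \<pi> m \<and> \<pi> m < c)" for m
    have "Q m \<longleftrightarrow> Z m" if "m \<in> {1..n} - {i, j, k}" for m
    proof -
      \<comment> \<open>By injectivity no other entry lies on a row border, so its value is in one
        of four open rows, and shaded and allowed rows are complementary.\<close>
      have "\<pi> m \<noteq> \<pi> i" "\<pi> m \<noteq> b" "\<pi> m \<noteq> c"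
        using that val(3) inj[of m] by (auto simp: doubleton_eq_iff)
      then consider "\<pi> m < \<pi> i" | "\<pi> i < \<pi> m" "\<pi> m < b" | "b < \<pi> m" "\<pi> m < c" | "c < \<pi> m"
        by linarith
      then show ?thesis
        unfolding Q_def Z_def using val(1,2) by cases auto
    qed
    then have "(\<forall>m \<in> {1..n} - {i, j, k}. Q m) \<longleftrightarrow> (\<forall>m \<in> {1..n} - {i, j, k}. Z m)"
      by blast
    moreover have "(\<forall>m \<in> {1..n} - {i, j, k}. Z m) \<longleftrightarrow> split_at n \<pi> i j k b c"
      unfolding split_at_def Z_def using ord val(1,2) by simp
    \<comment> \<open>The positions exempted by \<open>split_at\<close> lie on column borders, hence
      in no box.\<close>
    moreover have "Q i" "Q j" "Q k"
      unfolding Q_def using val ord by (auto simp: doubleton_eq_iff)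
    ultimately show ?thesis by blast
  qed
  finally show ?thesis .
qed

lemma occurrence_123_iff:
  assumes "\<pi> permutes {1..n}"
  shows "occurrence n \<pi> ([1,2,3], shading) is \<longleftrightarrow>
    (\<exists>i j k. is = [i, j, k] \<and> split_at n \<pi> i j k (\<pi> j) (\<pi> k))"
\<comment> \<open>On triples of the right shape \<open>sort\<close> can be evaluated and the shading
  equivalence applies; on all other lists both sides are false.\<close>
proof (cases "\<exists>i j k. is = [i, j, k] \<and> 1 \<le> i \<and> i < j \<and> j < k \<and> k \<le> n \<and> \<pi> i < \<pi> j \<and> \<pi> j < \<pi> k")
  case True
  then obtain i j k where eq: "is = [i, j, k]"
    and ord: "1 \<le> i" "i < j" "j < k" "k \<le> n" "\<pi> i < \<pi> j" "\<pi> j < \<pi> k" by blast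
  have "sorted_wrt (<) [i, j, k]" "set [i, j, k] \<subseteq> {1..n}"
    "order_isomorphic (map \<pi> [i, j, k]) [1,2,3]"
    and sort: "sort (map \<pi> [i, j, k]) = [\<pi> i, \<pi> j, \<pi> k]"
    using ord by (auto simp: order_isomorphic_123[simplified])
  then have "occurrence n \<pi> ([1,2,3], shading) is \<longleftrightarrow> split_at n \<pi> i j k (\<pi> j) (\<pi> k)"
    unfolding occurrence_def Let_def fst_conv snd_conv eq sort
      shading_conv_split_at[OF assms ord refl] by simp
  then show ?thesis by (simp add: eq)
next
  case False
  have "\<not> occurrence n \<pi> ([1,2,3], shading) is"
  proof
    assume "occurrence n \<pi> ([1,2,3], shading) is"
    then have "sorted_wrt (<) is" "set is \<subseteq> {1..n}" "order_isomorphic (map \<pi> is) [1,2,3]"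
      by (simp_all only: occurrence_def fst_conv)
    moreover from this(3) obtain i j k where "is = [i, j, k]" "\<pi> i < \<pi> j" "\<pi> j < \<pi> k"
      unfolding order_isomorphic_123 map_eq_3_conv by blast
    ultimately have "is = [i, j, k] \<and> 1 \<le> i \<and> i < j \<and> j < k \<and> k \<le> n \<and> \<pi> i < \<pi> j \<and> \<pi> j < \<pi> k"
      by simp
    with False show False by blast
  qed
  with False show ?thesis unfolding split_at_def by blast
qed

lemma occurrence_132_iff:
  assumes "\<pi> permutes {1..n}"
  shows "occurrence n \<pi> ([1,3,2], shading) is \<longleftrightarrow>
    (\<exists>i j k. is = [i, j, k] \<and> split_at n \<pi> i j k (\<pi> k) (\<pi> j))"
proof (cases "\<exists>i j k. is = [i, j, k] \<and> 1 \<le> i \<and> i < j \<and> j < k \<and> k \<le> n \<and> \<pi> i < \<pi> k \<and> \<pi> k < \<pi> j")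
  case True
  then obtain i j k where eq: "is = [i, j, k]"
    and ord: "1 \<le> i" "i < j" "j < k" "k \<le> n" "\<pi> i < \<pi> k" "\<pi> k < \<pi> j" by blast
  have "sorted_wrt (<) [i, j, k]" "set [i, j, k] \<subseteq> {1..n}"
    "order_isomorphic (map \<pi> [i, j, k]) [1,3,2]"
    and sort: "sort (map \<pi> [i, j, k]) = [\<pi> i, \<pi> k, \<pi> j]"
    using ord by (auto simp: order_isomorphic_132[simplified])
  \<comment> \<open>Here \<open>b\<close> is \<open>\<pi> k\<close> and \<open>c\<close> is
    \<open>\<pi> j\<close>, so \<open>{b, c} = {\<pi> j, \<pi> k}\<close> is an instance of
    \<open>insert_commute\<close>.\<close>
  then have "occurrence n \<pi> ([1,3,2], shading) is \<longleftrightarrow> split_at n \<pi> i j k (\<pi> k) (\<pi> j)"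
    unfolding occurrence_def Let_def fst_conv snd_conv eq sort
      shading_conv_split_at[OF assms ord insert_commute] by simp
  then show ?thesis by (simp add: eq)
next
  case False
  have "\<not> occurrence n \<pi> ([1,3,2], shading) is"
  proof
    assume "occurrence n \<pi> ([1,3,2], shading) is"
    then have "sorted_wrt (<) is" "set is \<subseteq> {1..n}" "order_isomorphic (map \<pi> is) [1,3,2]"
      by (simp_all only: occurrence_def fst_conv)
    moreover from this(3) obtain i j k where "is = [i, j, k]" "\<pi> i < \<pi> k" "\<pi> k < \<pi> j"
      unfolding order_isomorphic_132 map_eq_3_conv by blast
    ultimately have "is = [i, j, k] \<and> 1 \<le> i \<and> i < j \<and> j < k \<and> k \<le> n \<and> \<pi> i < \<pi> k \<and> \<pi> k < \<pi> j"
      by simp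
    with False show False by blast
  qed
  with False show ?thesis unfolding split_at_def by blast
qed

section \<open>Uniqueness of the occurrence of each pattern\<close>

lemma split_at_order:
  assumes "split_at n \<pi> i j k b c"
  shows "1 \<le> i" "i < j" "j < k" "k \<le> n" "\<pi> i < b" "b < c"
  using assms by (simp_all add: split_at_def)

lemma split_at_region:
  assumes "split_at n \<pi> i j k b c" "1 \<le> m" "m \<le> n" "m \<noteq> i" "m \<noteq> j" "m \<noteq> k"
  shows "m < i \<Longrightarrow> c < \<pi> m"
    and "i < m \<Longrightarrow> m < j \<Longrightarrow> \<pi> m < \<pi> i \<or> b < \<pi> m"
    and "j < m \<Longrightarrow> m < k \<Longrightarrow> \<pi> m < \<pi> i"
    and "k < m \<Longrightarrow> b < \<pi> m \<and> \<pi> m < c"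
  using assms by (simp_all add: split_at_def)

text \<open>If \<open>i < i'\<close>, then \<open>i\<close> lies in the block before
  \<open>i'\<close>, so \<open>c' < \<pi> i\<close>, while all entries from \<open>j'\<close> on are
  at most \<open>c'\<close>. As \<open>\<pi> k\<close> exceeds \<open>\<pi> i\<close>, this forces
  \<open>k < j'\<close>; then \<open>j'\<close> is in the last block of the first occurrence and
  \<open>\<pi> j' > b > c'\<close>, a contradiction.\<close>

lemma split_at_first_le:
  assumes s: "split_at n \<pi> i j k b c" "{b, c} = {\<pi> j, \<pi> k}"
    and s': "split_at n \<pi> i' j' k' b' c'" "{b', c'} = {\<pi> j', \<pi> k'}"
  shows "i' \<le> i"
proof (rule ccontr)
  assume "\<not> i' \<le> i"
  note ord = split_at_order[OF s(1)] and ord' = split_at_order[OF s'(1)]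
  have "c' < \<pi> i"
    using split_at_region(1)[OF s'(1), of i] ord ord' \<open>\<not> i' \<le> i\<close> by simp
  have "\<pi> i < \<pi> k"
    using ord s(2) by (auto simp: doubleton_eq_iff)
  have small: "\<pi> m \<le> c'" if "j' \<le> m" "m \<le> n" for m
  proof -
    have "\<pi> j' \<le> c'" "\<pi> k' \<le> c'"
      using ord' s'(2) by (auto simp: doubleton_eq_iff)
    moreover have "\<pi> m < c'" if "m \<noteq> j'" "m \<noteq> k'"
      using split_at_region(3,4)[OF s'(1), of m] that ord' \<open>j' \<le> m\<close> \<open>m \<le> n\<close> by linarith
    ultimately show ?thesis by (cases "m = j' \<or> m = k'") auto
  qed
  have "k < j'"
    using small[of k] ord \<open>c' < \<pi> i\<close> \<open>\<pi> i < \<pi> k\<close> by linarith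
  then have "b < \<pi> j'"
    using split_at_region(4)[OF s(1), of j'] ord ord' by linarith
  then show False
    using small[of j'] ord ord' \<open>c' < \<pi> i\<close> by linarith
qed

text \<open>With a common \<open>i\<close>, no block of the second occurrence to the right of
  \<open>i\<close> admits a value strictly between \<open>\<pi> i\<close> and \<open>b'\<close>. If
  \<open>b < b'\<close>, the entry \<open>b\<close> would be such a value.\<close>

lemma split_at_middle_le:
  assumes s: "split_at n \<pi> i j k b c" "{b, c} = {\<pi> j, \<pi> k}"
    and s': "split_at n \<pi> i j' k' b' c'" "{b', c'} = {\<pi> j', \<pi> k'}"
  shows "b' \<le> b"
proof (rule ccontr)
  assume "\<not> b' \<le> b"
  note ord = split_at_order[OF s(1)] and ord' = split_at_order[OF s'(1)]
  have "b \<in> {\<pi> j, \<pi> k}" using s(2) by blast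
  then obtain m where "m = j \<or> m = k" and m: "\<pi> m = b" by auto
  then have range: "1 \<le> m" "m \<le> n" "i < m"
    using ord by auto
  have "\<pi> m \<noteq> \<pi> j'" "\<pi> m \<noteq> \<pi> k'"
    using ord' s'(2) m \<open>\<not> b' \<le> b\<close> by (auto simp: doubleton_eq_iff)
  then have "m \<noteq> j'" "m \<noteq> k'" by auto
  then show False
    using split_at_region(2,3,4)[OF s'(1), of m] m range ord ord' \<open>\<not> b' \<le> b\<close> by linarith
qed

text \<open>Used to recover the position of \<open>c\<close> from that of \<open>b\<close>: both
  entries exceed \<open>\<pi> i\<close>, and nothing between them does.\<close>

lemma split_at_not_between:
  assumes "split_at n \<pi> i j k b c" "\<pi> i < \<pi> m"
  shows "\<not> (j < m \<and> m < k)"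
proof
  assume "j < m \<and> m < k"
  then have "\<pi> m < \<pi> i"
    using split_at_region(3)[OF assms(1), of m] split_at_order[OF assms(1)] by simp
  with assms(2) show False by simp
qed

lemma split_at_unique:
  assumes "split_at n \<pi> i j k b c" "{b, c} = {\<pi> j, \<pi> k}"
    and "split_at n \<pi> i' j' k' b' c'" "{b', c'} = {\<pi> j', \<pi> k'}"
  shows "i = i'" "b = b'"
proof -
  show i: "i = i'"
    using split_at_first_le[OF assms] split_at_first_le[OF assms(3,4,1,2)] by simp
  show "b = b'"
    using split_at_middle_le[OF assms(1,2) assms(3)[folded i] assms(4)]
      split_at_middle_le[OF assms(3)[folded i] assms(4) assms(1,2)] by simp
qed

lemma num_occurrences_123_le:
  assumes \<pi>: "\<pi> permutes {1..n}"
  shows "num_occurrences n \<pi> ([1,2,3], shading) \<le> 1"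
proof -
  have "xs = ys" if occ: "occurrence n \<pi> ([1,2,3], shading) xs"
    "occurrence n \<pi> ([1,2,3], shading) ys" for xs ys
  proof -
    obtain i j k i' j' k' where eq: "xs = [i, j, k]" "ys = [i', j', k']"
      and s: "split_at n \<pi> i j k (\<pi> j) (\<pi> k)" "split_at n \<pi> i' j' k' (\<pi> j') (\<pi> k')"
      using occ unfolding occurrence_123_iff[OF \<pi>] by blast
    have i: "i = i'" and "\<pi> j = \<pi> j'"
      using split_at_unique[OF s(1) refl s(2) refl] by auto
    \<comment> \<open>In 123 the value \<open>b\<close> sits at \<open>j\<close>. Both
      \<open>k\<close> and \<open>k'\<close> carry values above \<open>\<pi> i\<close>, so neither
      can lie strictly between \<open>j\<close> and the other.\<close>
    then have j: "j = j'" using permutes_inj[OF \<pi>] by (simp add: inj_eq)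
    have "k = k'"
      using split_at_not_between[OF s(2), of k] split_at_not_between[OF s(1), of k']
        split_at_order[OF s(1)] split_at_order[OF s(2)] i j by simp
    with i j eq show ?thesis by simp
  qed
  then show ?thesis
    unfolding num_occurrences_def using finite_occurrences
    by (auto simp: card_le_Suc0_iff_eq)
qed

lemma num_occurrences_132_le:
  assumes \<pi>: "\<pi> permutes {1..n}"
  shows "num_occurrences n \<pi> ([1,3,2], shading) \<le> 1"
proof -
  have "xs = ys" if occ: "occurrence n \<pi> ([1,3,2], shading) xs"
    "occurrence n \<pi> ([1,3,2], shading) ys" for xs ys
  proof -
    obtain i j k i' j' k' where eq: "xs = [i, j, k]" "ys = [i', j', k']"
      and s: "split_at n \<pi> i j k (\<pi> k) (\<pi> j)" "split_at n \<pi> i' j' k' (\<pi> k') (\<pi> j')"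
      using occ unfolding occurrence_132_iff[OF \<pi>] by blast
    have i: "i = i'" and "\<pi> k = \<pi> k'"
      using split_at_unique[OF s(1) insert_commute s(2) insert_commute] by auto
    \<comment> \<open>In 132 the value \<open>b\<close> sits at \<open>k\<close>, so
      \<open>k\<close> is found first and \<open>j\<close> follows from it.\<close>
    then have k: "k = k'" using permutes_inj[OF \<pi>] by (simp add: inj_eq)
    have "j = j'"
      using split_at_not_between[OF s(2), of j] split_at_not_between[OF s(1), of j']
        split_at_order[OF s(1)] split_at_order[OF s(2)] i k by simp
    with i k eq show ?thesis by simp
  qed
  then show ?thesis
    unfolding num_occurrences_def using finite_occurrences
    by (auto simp: card_le_Suc0_iff_eq)
qed

section \<open>Exchange of the entries \<open>b\<close> and \<open>c\<close>\<close>

text \<open>Only the entries at \<open>j\<close> and \<open>k\<close> change, and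
  \<open>split_at\<close> reads no value there; \<open>i < j\<close> keeps \<open>\<pi> i\<close>
  fixed.\<close>

lemma split_at_swap:
  assumes "i < j" "j < k"
  shows "split_at n (\<pi> \<circ> transpose j k) i j k b c \<longleftrightarrow> split_at n \<pi> i j k b c"
proof -
  have "(\<pi> \<circ> transpose j k) m = \<pi> m" if "m \<noteq> j" "m \<noteq> k" for m
    using that by (simp add: transpose_def)
  then show ?thesis
    unfolding split_at_def using assms by simp
qed

lemma card_containing_123_eq_132:
  "card {(\<pi>, is). \<pi> permutes {1..n} \<and> occurrence n \<pi> ([1,2,3], shading) is} =
   card {(\<pi>, is). \<pi> permutes {1..n} \<and> occurrence n \<pi> ([1,3,2], shading) is}" (is "card ?A = card ?B")
proof -
  \<comment> \<open>List indices start at 0, so \<open>is ! 1\<close> and \<open>is ! 2\<close> are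
    \<open>j\<close> and \<open>k\<close>. The list is left unchanged, which makes \<open>f\<close>
    its own inverse.\<close>
  define f :: "(nat \<Rightarrow> nat) \<times> nat list \<Rightarrow> (nat \<Rightarrow> nat) \<times> nat list" where
    "f = (\<lambda>(\<pi>, is). (\<pi> \<circ> transpose (is ! 1) (is ! 2), is))"
  have f: "f (\<pi>, [i, j, k]) = (\<pi> \<circ> transpose j k, [i, j, k])" for \<pi> i j k
    by (simp add: f_def)
  have ff: "f (f x) = x" for x
    by (cases x) (simp add: f_def o_assoc[symmetric])
  have perm: "\<pi> \<circ> transpose j k permutes {1..n}"
    if "\<pi> permutes {1..n}" "split_at n \<pi> i j k b c" for \<pi> i j k b c
    using that by (intro permutes_compose permutes_swap_id) (auto simp: split_at_def)
  have swap: "split_at n (\<pi> \<circ> transpose j k) i j k b c" if "split_at n \<pi> i j k b c" for \<pi> i j k b c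
    using that split_at_swap by (auto simp: split_at_def)
  have AB: "f x \<in> ?B" if x_in: "x \<in> ?A" for x
  proof -
    obtain \<pi> "is" where x: "x = (\<pi>, is)" and \<pi>: "\<pi> permutes {1..n}"
      and "occurrence n \<pi> ([1,2,3], shading) is"
      using x_in by blast
    then obtain i j k where "is": "is = [i, j, k]" and s: "split_at n \<pi> i j k (\<pi> j) (\<pi> k)"
      unfolding occurrence_123_iff[OF \<pi>] by blast
    \<comment> \<open>The parameters \<open>b\<close> and \<open>c\<close> persist, but the swapped
      permutation takes \<open>b\<close> at \<open>k\<close> and \<open>c\<close> at
      \<open>j\<close>, which is the form for 132.\<close>
    show ?thesis
      using occurrence_132_iff[OF perm[OF \<pi> s]] perm[OF \<pi> s] swap[OF s] unfolding x "is" f by simp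
  qed
  have BA: "f x \<in> ?A" if x_in: "x \<in> ?B" for x
  proof -
    obtain \<pi> "is" where x: "x = (\<pi>, is)" and \<pi>: "\<pi> permutes {1..n}"
      and "occurrence n \<pi> ([1,3,2], shading) is"
      using x_in by blast
    then obtain i j k where "is": "is = [i, j, k]" and s: "split_at n \<pi> i j k (\<pi> k) (\<pi> j)"
      unfolding occurrence_132_iff[OF \<pi>] by blast
    show ?thesis
      using occurrence_123_iff[OF perm[OF \<pi> s]] perm[OF \<pi> s] swap[OF s] unfolding x "is" f by simp
  qed
  have "bij_betw f ?A ?B"
  proof (rule bij_betw_byWitness[where f' = f])
    show "f ` ?A \<subseteq> ?B" by (rule image_subsetI) (rule AB)
    show "f ` ?B \<subseteq> ?A" by (rule image_subsetI) (rule BA)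
  qed (simp_all only: ff ball_triv simp_thms)
  then show ?thesis by (rule bij_betw_same_card)
qed

lemma jointly_equidistributed_shading: "([1,2,3], shading) \<sim>jd ([1,3,2], shading)"
proof (rule jointly_equidistributedI)
  show "card {\<pi>. \<pi> permutes {1..n} \<and> num_occurrences n \<pi> ([1,2,3], shading) = 1} =
    card {\<pi>. \<pi> permutes {1..n} \<and> num_occurrences n \<pi> ([1,3,2], shading) = 1}" for n
    using card_unique_occurrence[of n "([1,2,3], shading)"]
      card_unique_occurrence[of n "([1,3,2], shading)"]
      num_occurrences_123_le num_occurrences_132_le card_containing_123_eq_132 by presburger
qed (fact num_occurrences_123_le num_occurrences_132_le)+

section \<open>Inverse permutations and transposed shadings\<close>

text \<open>Read in increasing order, the values of an occurrence are positions in
  \<open>inv \<pi>\<close>, and the entries there form the inverse pattern. Both patterns are their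
  own inverses.\<close>

lemma order_isomorphic_inverse:
  assumes "\<tau> = [1,2,3] \<or> \<tau> = [1,3,2]" "\<pi> permutes S" "sorted_wrt (<) is"
    and "order_isomorphic (map \<pi> is) \<tau>"
  shows "order_isomorphic (map (inv \<pi>) (sort (map \<pi> is))) \<tau>"
  using assms(1)
proof
  assume \<tau>: "\<tau> = [1,2,3]"
  then obtain i j k where "is = [i, j, k]" "\<pi> i < \<pi> j" "\<pi> j < \<pi> k"
    using assms(4) by (auto simp: order_isomorphic_123[simplified] map_eq_3_conv)
  then show ?thesis
    using assms(3) permutes_inverses[OF assms(2)] unfolding \<tau> by (simp add: order_isomorphic_123[simplified])
next
  assume \<tau>: "\<tau> = [1,3,2]"
  then obtain i j k where "is = [i, j, k]" "\<pi> i < \<pi> k" "\<pi> k < \<pi> j"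
    using assms(4) by (auto simp: order_isomorphic_132[simplified] map_eq_3_conv)
  then show ?thesis
    using assms(3) permutes_inverses[OF assms(2)] unfolding \<tau> by (simp add: order_isomorphic_132[simplified])
qed

lemma sort_map_inv_sort_map:
  assumes "\<pi> permutes S" "sorted is"
  shows "sort (map (inv \<pi>) (sort (map \<pi> is))) = is"
proof (rule properties_for_sort)
  show "mset is = mset (map (inv \<pi>) (sort (map \<pi> is)))"
    using permutes_inverses[OF assms(1)] by (simp add: multiset.map_comp o_def)
qed fact

text \<open>Reflection in the diagonal exchanges the position list with the sorted value list, hence
  the box \<open>(a, b)\<close> with \<open>(b, a)\<close>.\<close>

lemma occurrence_inverse:
  assumes \<tau>: "\<tau> = [1,2,3] \<or> \<tau> = [1,3,2]" and \<pi>: "\<pi> permutes {1..n}"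
    and occ: "occurrence n \<pi> (\<tau>, T) is"
  shows "occurrence n (inv \<pi>) (\<tau>, T\<inverse>) (sort (map \<pi> is))"
proof -
  have sorted: "sorted_wrt (<) is" and set: "set is \<subseteq> {1..n}"
    and iso: "order_isomorphic (map \<pi> is) \<tau>"
    using occ by (auto simp: occurrence_def)
  have "distinct (map \<pi> is)"
    using sorted permutes_inj_on[OF \<pi>] by (simp add: distinct_map strict_sorted_iff)
  then have "sorted_wrt (<) (sort (map \<pi> is))"
    by (simp add: strict_sorted_iff)
  moreover have "set (sort (map \<pi> is)) \<subseteq> {1..n}"
    using set permutes_image[OF \<pi>] by auto
  moreover have "sort (map (inv \<pi>) (sort (map \<pi> is))) = is"
    using sort_map_inv_sort_map[OF \<pi>] sorted by (simp add: strict_sorted_iff)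
  moreover have "\<not> (\<exists>m. (0 # sort (map \<pi> is) @ [n + 1]) ! b < m \<and>
        m < (0 # sort (map \<pi> is) @ [n + 1]) ! (b + 1) \<and>
        (0 # is @ [n + 1]) ! a < inv \<pi> m \<and> inv \<pi> m < (0 # is @ [n + 1]) ! (a + 1))"
    if "(a, b) \<in> T" for a b
  proof -
    have "\<not> (\<exists>m. (0 # is @ [n + 1]) ! a < m \<and> m < (0 # is @ [n + 1]) ! (a + 1) \<and>
        (0 # sort (map \<pi> is) @ [n + 1]) ! b < \<pi> m \<and>
        \<pi> m < (0 # sort (map \<pi> is) @ [n + 1]) ! (b + 1))"
      using occ that unfolding occurrence_def Let_def by fastforce
    \<comment> \<open>A point \<open>m\<close> of \<open>inv \<pi>\<close> in the box
      \<open>(b, a)\<close> would give the point \<open>inv \<pi> m\<close> of \<open>\<pi>\<close>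
      in the box \<open>(a, b)\<close>.\<close>
    then show ?thesis
      by (metis permutes_inverses(1)[OF \<pi>])
  qed
  ultimately show ?thesis
    using order_isomorphic_inverse[OF \<tau> \<pi> sorted iso]
    unfolding occurrence_def Let_def by auto
qed

lemma num_occurrences_inverse:
  assumes \<tau>: "\<tau> = [1,2,3] \<or> \<tau> = [1,3,2]" and \<pi>: "\<pi> permutes {1..n}"
  shows "num_occurrences n (inv \<pi>) (\<tau>, T\<inverse>) = num_occurrences n \<pi> (\<tau>, T)"
proof -
  have inv: "inv \<pi> permutes {1..n}" "inv (inv \<pi>) = \<pi>"
    using permutes_inv[OF \<pi>] permutes_inv_inv[OF \<pi>] by auto
  have sorted: "sorted is" if "occurrence n \<rho> q is" for \<rho> q "is"
    using that by (simp add: occurrence_def strict_sorted_iff)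
  have "bij_betw (\<lambda>is. sort (map \<pi> is)) {is. occurrence n \<pi> (\<tau>, T) is}
      {is. occurrence n (inv \<pi>) (\<tau>, T\<inverse>) is}"
  proof (rule bij_betw_byWitness[where f' = "\<lambda>is. sort (map (inv \<pi>) is)"])
    show "\<forall>is \<in> {is. occurrence n \<pi> (\<tau>, T) is}. sort (map (inv \<pi>) (sort (map \<pi> is))) = is"
      using sort_map_inv_sort_map[OF \<pi>] sorted by blast
    show "\<forall>is \<in> {is. occurrence n (inv \<pi>) (\<tau>, T\<inverse>) is}. sort (map \<pi> (sort (map (inv \<pi>) is))) = is"
      using sort_map_inv_sort_map[OF inv(1)] sorted unfolding inv(2) by blast
    show "(\<lambda>is. sort (map \<pi> is)) ` {is. occurrence n \<pi> (\<tau>, T) is}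
        \<subseteq> {is. occurrence n (inv \<pi>) (\<tau>, T\<inverse>) is}"
      using occurrence_inverse[OF \<tau> \<pi>] by blast
    \<comment> \<open>The same lemma applied to \<open>inv \<pi>\<close> and
      \<open>T\<inverse>\<close>, where the double inverse and double converse cancel.\<close>
    show "(\<lambda>is. sort (map (inv \<pi>) is)) ` {is. occurrence n (inv \<pi>) (\<tau>, T\<inverse>) is}
        \<subseteq> {is. occurrence n \<pi> (\<tau>, T) is}"
      using occurrence_inverse[OF \<tau> inv(1), of "T\<inverse>"] unfolding inv(2) converse_converse by blast
  qed
  then show ?thesis
    unfolding num_occurrences_def by (simp add: bij_betw_same_card)
qed

text \<open>Inversion is a bijection on permutations that carries both counts at once from
  \<open>T\<close> to \<open>T\<inverse>\<close>, so each joint class keeps its size.\<close>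

lemma jointly_equidistributed_converse:
  assumes "([1,2,3], T) \<sim>jd ([1,3,2], T)"
  shows "([1,2,3], T\<inverse>) \<sim>jd ([1,3,2], T\<inverse>)"
proof -
  have "card {\<pi>. \<pi> permutes {1..n} \<and> num_occurrences n \<pi> ([1,2,3], T\<inverse>) = k \<and>
          num_occurrences n \<pi> ([1,3,2], T\<inverse>) = l} =
        card {\<pi>. \<pi> permutes {1..n} \<and> num_occurrences n \<pi> ([1,2,3], T) = k \<and>
          num_occurrences n \<pi> ([1,3,2], T) = l}" (is "card ?A = card ?B") for n k l
  proof -
    have "bij_betw inv ?B ?A"
    proof (rule bij_betw_byWitness[where f' = inv])
      show "inv ` ?B \<subseteq> ?A"
        using num_occurrences_inverse[of _ _ n T] permutes_inv by auto
      show "inv ` ?A \<subseteq> ?B"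
        using num_occurrences_inverse[of _ _ n "T\<inverse>"] permutes_inv by auto
    qed (auto simp: permutes_inv_inv)
    then show ?thesis by (simp add: bij_betw_same_card)
  qed
  with assms show ?thesis
    unfolding jointly_equidistributed_def by simp
qed

theorem theorem3p8:
  fixes R R' :: "(nat \<times> nat) set"
  assumes "R = {(0,0), (0,1), (0,2), (3,0), (1,1), (2,1), (2,2), (2,3), (3,1), (3,3)}"
    and "R' = {(0,0), (1,0), (2,0), (0,3), (1,1), (1,2), (1,3), (2,2), (3,2), (3,3)}"
  shows "([1,2,3], R) \<sim>jd ([1,3,2], R) \<and> ([1,2,3], R') \<sim>jd ([1,3,2], R')"
proof -
  have "R' = R\<inverse>"
    unfolding assms by auto
  then show ?thesis
    using jointly_equidistributed_shading jointly_equidistributed_converse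
    unfolding assms(1) by blast
qed

end
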